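(* Let $X$ be a Banach space, $x_0\in X$, $R>0$, and let $A: B[x_0,R]\to X$ be an operator which satisfies the variable Lipschitz condition in the ball $B[x_0,R]$ with a nonnegative function $k(\cdot)$ on $[0,R]$. Suppose that the majorant functions $a_+(\cdot)$ and $a_-(\cdot)$ of $A$ have fixed points in the interval $[0,R]$. Then $A$ has a unique fixed point $x^*\in L[x_0,r_*,r^*]$, and it is also unique in each ball $B[x_0,r]$ where $r^*\le r<r^{**}$ (i.e. there are no fixed points of $A$ in $B[x_0,r_*]\cup L(x_0,r^*,r^{**})$).
   Context: Notation: $B[x_0,r]=\{x\in X:\|x-x_0\|\le r\}$ is the closed ball. A fixed point of $A$ is a point $x\in B[x_0,R]$ with $Ax=x$. Variable Lipschitz condition: $A$ satisfies the variable Lipschitz condition in $B[x_0,R]$ with a nonnegative function $k(\cdot)$ on $[0,R]$ if, for every $r$ with $0<r\le R$ and all $x_1,x_2$ with $\|x_1-x_0\|\le r$, $\|x_2-x_0\|\le r$, one has $\|Ax_1-Ax_2\|\le k(r)\|x_1-x_2\|$. The function $k$ is assumed to be integrable on $[0,R]$, so that the integrals below make sense. Majorant functions: for $r\in[0,R]$, $a_\pm(r)=a\pm\int_0^r k(t)\,dt$, where $a=\|Ax_0-x_0\|$. $r^*$ denotes the smallest fixed point of $a_+$ in $[0,R]$, and $r_*$ denotes the smallest fixed point of $a_-$ in $[0,R]$. $r^{**}=\sup\{r:\ r^*<r\le R,\ a_+(r)<r\}$ provided that this set is nonempty; if the set is empty, put $r^{**}=r^*$ (so that there are no radii with $r^*\le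 r<r^{**}$ and the set $L(x_0,r^*,r^{**})$ is empty). $L(x_0,r^*,r^{**})=\{x:\ r^*<\|x-x_0\|<r^{**}\}$ if $a_+(R)\ge R$, and $L(x_0,r^*,r^{**})=\{x:\ r^*<\|x-x_0\|\le r^{**}\}$ if $a_+(R)<R$. $L[x_0,r_*,r^*]=\{x:\ r_*\le\|x-x_0\|\le r^*\}$.
   Formalization: The claim of no fixed points in B[x0,r_*] is corrected to: no fixed points other than x^* there, since x^* may lie on the sphere of radius r_* (e.g. A constant, k = 0). *)

theory Defs
  imports "HOL-Analysis.Analysis"
begin

definition variable_lipschitz ::
  "'a::real_normed_vector \<Rightarrow> real \<Rightarrow> (real \<Rightarrow> real) \<Rightarrow> ('a \<Rightarrow> 'a) \<Rightarrow> bool" where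
  "variable_lipschitz x0 R k A \<longleftrightarrow>
    (\<forall>r x1 x2. 0 < r \<and> r \<le> R \<and> norm (x1 - x0) \<le> r \<and> norm (x2 - x0) \<le> r \<longrightarrow>
       norm (A x1 - A x2) \<le> k r * norm (x1 - x2))"

(* Operators are total functions on 'a; their values outside the ball are never used. *)
definition fixed_points :: "'a::real_normed_vector \<Rightarrow> real \<Rightarrow> ('a \<Rightarrow> 'a) \<Rightarrow> 'a set" where
  "fixed_points x0 R A = {x \<in> cball x0 R. A x = x}"

(* The integral is the Henstock-Kurzweil one.  It is only used for nonnegative k, where
   Henstock-Kurzweil and Lebesgue integrability, and the two integrals, coincide. *)
definition majorant_plus ::
  "'a::real_normed_vector \<Rightarrow> (real \<Rightarrow> real) \<Rightarrow> ('a \<Rightarrow> 'a) \<Rightarrow> real \<Rightarrow> real" where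
  "majorant_plus x0 k A r = norm (A x0 - x0) + integral {0..r} k"

definition majorant_minus ::
  "'a::real_normed_vector \<Rightarrow> (real \<Rightarrow> real) \<Rightarrow> ('a \<Rightarrow> 'a) \<Rightarrow> real \<Rightarrow> real" where
  "majorant_minus x0 k A r = norm (A x0 - x0) - integral {0..r} k"

(* The radius r^*.  If a fixed point exists then a smallest one exists, by continuity of the
   majorant, so LEAST denotes it; likewise for r_* below. *)
definition radius_upper ::
  "'a::real_normed_vector \<Rightarrow> real \<Rightarrow> (real \<Rightarrow> real) \<Rightarrow> ('a \<Rightarrow> 'a) \<Rightarrow> real" where
  "radius_upper x0 R k A = (LEAST r. r \<in> {0..R} \<and> majorant_plus x0 k A r = r)"

(* The radius r_*. *)
definition radius_lower ::
  "'a::real_normed_vector \<Rightarrow> real \<Rightarrow> (real \<Rightarrow> real) \<Rightarrow> ('a \<Rightarrow> 'a) \<Rightarrow> real" where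
  "radius_lower x0 R k A = (LEAST r. r \<in> {0..R} \<and> majorant_minus x0 k A r = r)"

(* The radius r^{**}. *)
definition radius_unique ::
  "'a::real_normed_vector \<Rightarrow> real \<Rightarrow> (real \<Rightarrow> real) \<Rightarrow> ('a \<Rightarrow> 'a) \<Rightarrow> real" where
  "radius_unique x0 R k A =
    (let S = {r. radius_upper x0 R k A < r \<and> r \<le> R \<and> majorant_plus x0 k A r < r}
     in if S = {} then radius_upper x0 R k A else Sup S)"

(* L[x0, r_*, r^*] *)
definition existence_layer ::
  "'a::real_normed_vector \<Rightarrow> real \<Rightarrow> (real \<Rightarrow> real) \<Rightarrow> ('a \<Rightarrow> 'a) \<Rightarrow> 'a set" where
  "existence_layer x0 R k A =
    {x. radius_lower x0 R k A \<le> norm (x - x0) \<and> norm (x - x0) \<le> radius_upper x0 R k A}"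

(* L(x0, r^*, r^{**}) *)
definition nonexistence_layer ::
  "'a::real_normed_vector \<Rightarrow> real \<Rightarrow> (real \<Rightarrow> real) \<Rightarrow> ('a \<Rightarrow> 'a) \<Rightarrow> 'a set" where
  "nonexistence_layer x0 R k A =
    (if majorant_plus x0 k A R \<ge> R
     then {x. radius_upper x0 R k A < norm (x - x0) \<and> norm (x - x0) < radius_unique x0 R k A}
     else {x. radius_upper x0 R k A < norm (x - x0) \<and> norm (x - x0) \<le> radius_unique x0 R k A})"

end

theory Submission
  imports Defs
begin

text \<open>
  The argument compares the Picard iterates of \<open>A\<close> with the iterates of the scalar majorant
  \<open>a\<^sub>+\<close>.  Everything rests on one estimate (\<open>norm_diff_le_integral\<close>): integrating the
  Lipschitz condition along a segment that starts in the ball of radius \<open>\<rho>\<close> gives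
  \<open>\<parallel>A y - A x\<parallel> \<le> \<integral>\<^bsub>\<rho>\<^esub>\<^bsup>\<sigma>\<^esup> k\<close>
  whenever \<open>\<parallel>x - x\<^sub>0\<parallel> \<le> \<rho>\<close> and \<open>\<parallel>y - x\<parallel> \<le> \<sigma> - \<rho>\<close>.

  Put \<open>\<rho>\<^sub>0 = 0\<close> and \<open>\<rho>\<^sub>n\<^sub>+\<^sub>1 = a\<^sub>+(\<rho>\<^sub>n)\<close>; this sequence increases to \<open>r\<^sup>*\<close>.  The estimate shows by
  induction that the Picard iterates satisfy \<open>\<parallel>x\<^sub>n\<^sub>+\<^sub>1 - x\<^sub>n\<parallel> \<le> \<rho>\<^sub>n\<^sub>+\<^sub>1 - \<rho>\<^sub>n\<close>, so they converge to a
  fixed point in the ball of radius \<open>r\<^sup>*\<close>; and that every fixed point \<open>y\<close> in that ball satisfies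
  \<open>\<parallel>y - x\<^sub>n\<parallel> \<le> r\<^sup>* - \<rho>\<^sub>n\<close>, so it is the limit of the iterates.

  The remaining claims concern an arbitrary fixed point \<open>y\<close> at distance \<open>\<rho>\<close> from \<open>x\<^sub>0\<close>.  The estimate
  between \<open>x\<^sub>0\<close> and \<open>y\<close> gives \<open>a\<^sub>-(\<rho>) \<le> \<rho> \<le> a\<^sub>+(\<rho>)\<close>.  The left inequality and continuity of
  \<open>a\<^sub>-\<close> produce a fixed point of \<open>a\<^sub>-\<close> in \<open>[0,\<rho>]\<close>, hence \<open>r\<^sub>* \<le> \<rho>\<close>.  If moreover \<open>\<rho> \<le> r\<close> for
  some \<open>r\<close> with \<open>a\<^sub>+(r) < r\<close>, the right inequality says that \<open>k\<close> has mean value less than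
  \<open>1\<close> over \<open>[\<rho>,r]\<close>, so \<open>k(\<tau>) < 1\<close> for some \<open>\<tau> \<ge> \<rho>\<close>.  When \<open>\<rho> > r\<^sup>*\<close> the ball of radius \<open>\<tau>\<close>
  contains both \<open>y\<close> and the fixed point already found, and \<open>A\<close> is a contraction there; this is
  impossible for two distinct fixed points.  A scalar iteration started at \<open>r\<close> would not give this
  directly: \<open>k\<close> may decrease, so \<open>a\<^sub>+\<close> may have further fixed points between \<open>r\<^sup>*\<close> and \<open>r\<close>, at
  which that iteration stops.
\<close>

section \<open>Scalar functions on a compact interval\<close>

lemma Least_fixed_point_interval:
  fixes f :: "real \<Rightarrow> real"
  assumes "continuous_on {0..R} f" "\<exists>r\<in>{0..R}. f r = r"
  defines "m \<equiv> (LEAST r. r \<in> {0..R} \<and> f r = r)"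
  shows "m \<in> {0..R}" "f m = m" "\<And>r. r \<in> {0..R} \<Longrightarrow> f r = r \<Longrightarrow> m \<le> r"
proof -
  let ?F = "{r \<in> {0..R}. f r - r = 0}"
  have "continuous_on {0..R} (\<lambda>r. f r - r)"
    using assms(1) by (intro continuous_intros)
  then have "closed ?F"
    using continuous_closed_preimage_constant[of "{0..R}" "\<lambda>r. f r - r" 0] by simp
  moreover have "bounded ?F"
    by (rule bounded_subset[of "{0..R}"]) auto
  ultimately have "compact ?F"
    by (simp add: compact_eq_bounded_closed)
  moreover have "?F \<noteq> {}" using assms(2) by auto
  ultimately have "\<exists>s\<in>?F. \<forall>t\<in>?F. s \<le> t"
    by (rule compact_attains_inf)
  then obtain s where s: "s \<in> ?F" "\<forall>t\<in>?F. s \<le> t" ..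
  have "m = s"
    unfolding m_def using s by (intro Least_equality) auto
  with s show "m \<in> {0..R}" "f m = m" "\<And>r. r \<in> {0..R} \<Longrightarrow> f r = r \<Longrightarrow> m \<le> r"
    by auto
qed

lemma exists_less_of_integral_less:
  fixes k :: "real \<Rightarrow> real"
  assumes "k integrable_on {u..v}" "integral {u..v} k < v - u" "u \<le> v"
  shows "\<exists>t\<in>{u..v}. k t < 1"
proof (rule ccontr)
  assume "\<not> ?thesis"
  then have "\<And>t. t \<in> {u..v} \<Longrightarrow> 1 \<le> k t" by force
  then have "integral {u..v} (\<lambda>_. 1) \<le> integral {u..v} k"
    using assms(1) by (intro integral_le) auto
  then show False using assms(2,3) by simp
qed

section \<open>Operators with a variable Lipschitz condition\<close>

locale variable_lipschitz_operator =
  fixes x0 :: "'a::real_normed_vector" and R :: real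
    and k :: "real \<Rightarrow> real" and A :: "'a \<Rightarrow> 'a"
  assumes R_pos: "R > 0"
    and k_nonneg: "\<And>t. 0 \<le> t \<Longrightarrow> t \<le> R \<Longrightarrow> 0 \<le> k t"
    and k_integrable: "k integrable_on {0..R}"
    and variable_lipschitz: "variable_lipschitz x0 R k A"
begin

abbreviation "ap \<equiv> majorant_plus x0 k A"
abbreviation "am \<equiv> majorant_minus x0 k A"

lemma lipschitz:
  assumes "0 < r" "r \<le> R" "norm (x - x0) \<le> r" "norm (y - x0) \<le> r"
  shows "norm (A x - A y) \<le> k r * norm (x - y)"
  using variable_lipschitz assms unfolding variable_lipschitz_def by blast

lemma k_integrable_subinterval:
  assumes "0 \<le> u" "v \<le> R"
  shows "k integrable_on {u..v}"
  using integrable_subinterval_real[OF k_integrable] assms by simp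

lemma integral_split:
  assumes "0 \<le> u" "u \<le> v" "v \<le> R"
  shows "integral {u..v} k = integral {0..v} k - integral {0..u} k"
  using Henstock_Kurzweil_Integration.integral_combine[of 0 u v k] assms
    k_integrable_subinterval[of 0 v] by simp

lemma integral_k_nonneg:
  assumes "0 \<le> u" "v \<le> R"
  shows "0 \<le> integral {u..v} k"
  using assms k_nonneg by (intro integral_nonneg k_integrable_subinterval) auto

lemma continuous_majorants:
  "continuous_on {0..R} ap" "continuous_on {0..R} am"
  unfolding majorant_plus_def majorant_minus_def
  by (intro continuous_intros indefinite_integral_continuous_1 k_integrable)+

lemma majorant_plus_diff:
  assumes "0 \<le> u" "u \<le> v" "v \<le> R"
  shows "ap v - ap u = integral {u..v} k"
  using integral_split[OF assms] by (simp add: majorant_plus_def)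

lemma majorant_plus_mono:
  assumes "0 \<le> u" "u \<le> v" "v \<le> R"
  shows "ap u \<le> ap v"
  using majorant_plus_diff[OF assms] integral_k_nonneg[of u v] assms by simp

text \<open>
  Cut the segment from \<open>x\<close> to \<open>y\<close> into \<open>n\<close> equal pieces and let \<open>h = (\<sigma> - \<rho>) / n\<close>.  The piece
  number \<open>i\<close> lies in the ball of radius \<open>\<rho> + (i + 1) h\<close>, so \<open>A\<close> maps its end points to points at
  distance at most \<open>k \<tau> * h\<close>, for \<^emph>\<open>every\<close> \<open>\<tau> \<le> R\<close> beyond that radius.  Averaging over the next radial cell
  \<open>\<tau> \<in> [\<rho> + (i + 1) h, \<rho> + (i + 2) h]\<close> bounds it by the integral of \<open>k\<close> over that cell.  The sum
  telescopes; only the last piece has no next cell, and its contribution \<open>k \<sigma> * h\<close> vanishes as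
  \<open>n\<close> grows.  The cell belonging to the piece itself would not do: \<open>k\<close> is a Lipschitz constant
  for the whole piece only from its outer radius on.
\<close>
lemma norm_diff_le_integral:
  assumes x: "norm (x - x0) \<le> \<rho>" and y: "norm (y - x) \<le> \<sigma> - \<rho>" and \<sigma>: "\<sigma> \<le> R"
  shows "norm (A y - A x) \<le> integral {\<rho>..\<sigma>} k"
proof (cases "\<sigma> = \<rho>")
  case True
  then show ?thesis using y by simp
next
  case False
  define d where "d = \<sigma> - \<rho>"
  have d: "d > 0" using False y norm_ge_zero[of "y - x"] unfolding d_def by linarith
  have \<rho>: "0 \<le> \<rho>" using x norm_ge_zero[of "x - x0"] by linarith
  have k\<sigma>: "0 \<le> k \<sigma>" using k_nonneg[of \<sigma>] \<sigma> \<rho> d d_def by auto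
  have approx: "norm (A y - A x) \<le> integral {\<rho>..\<sigma>} k + k \<sigma> * d / real (Suc N)" for N
  proof -
    define n where "n = real (Suc N)"
    have n: "n > 0" by (simp add: n_def)
    define h where "h = d / n"
    have h: "h > 0" using d n by (simp add: h_def)
    have nh: "n * h = d" using n by (simp add: h_def)
    define z where "z i = x + (real i / n) *\<^sub>R (y - x)" for i
    have z_in: "norm (z i - x0) \<le> \<rho> + real i * h" for i
    proof -
      have "z i - x0 = (x - x0) + (real i / n) *\<^sub>R (y - x)" by (simp add: z_def)
      then have "norm (z i - x0) \<le> norm (x - x0) + real i / n * norm (y - x)"
        using norm_triangle_ineq[of "x - x0" "(real i / n) *\<^sub>R (y - x)"] n by (simp only: norm_scaleR) simp
      also have "\<dots> \<le> \<rho> + real i / n * d"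
        using x y n unfolding d_def by (intro add_mono mult_left_mono) auto
      finally show ?thesis by (simp add: h_def)
    qed
    have z_step: "norm (z (Suc i) - z i) \<le> h" for i
    proof -
      have "z (Suc i) - z i = (1 / n) *\<^sub>R (y - x)"
        by (simp add: z_def add_divide_distrib flip: scaleR_diff_left)
      then have "norm (z (Suc i) - z i) = norm (y - x) / n" using n by simp
      also have "\<dots> \<le> h" unfolding h_def d_def using y n by (intro divide_right_mono) auto
      finally show ?thesis .
    qed
    have Az_step: "norm (A (z (Suc i)) - A (z i)) \<le> k \<tau> * h"
      if "\<rho> + real (Suc i) * h \<le> \<tau>" "\<tau> \<le> R" for i \<tau>
    proof -
      have "0 < real (Suc i) * h" using h by simp
      then have "0 < \<tau>" using that \<rho> by linarith
      moreover have "norm (z i - x0) \<le> \<tau>"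
        using z_in[of i] that h by (simp add: algebra_simps)
      ultimately have "norm (A (z (Suc i)) - A (z i)) \<le> k \<tau> * norm (z (Suc i) - z i)"
        using z_in[of "Suc i"] that by (intro lipschitz) auto
      also have "\<dots> \<le> k \<tau> * h"
        using z_step k_nonneg[of \<tau>] \<open>0 < \<tau>\<close> that by (intro mult_left_mono) auto
      finally show ?thesis .
    qed
    have cell: "norm (A (z (Suc i)) - A (z i))
        \<le> integral {\<rho> + real (Suc i) * h..\<rho> + real (Suc (Suc i)) * h} k"
      if "Suc (Suc i) \<le> Suc N" for i
    proof -
      let ?u = "\<rho> + real (Suc i) * h" and ?v = "\<rho> + real (Suc (Suc i)) * h"
      let ?c = "norm (A (z (Suc i)) - A (z i)) / h"
      have uv: "?v = ?u + h" by (simp add: algebra_simps)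
      have "real (Suc (Suc i)) * h \<le> n * h"
        using that h unfolding n_def by (intro mult_right_mono) auto
      then have v: "?v \<le> R" using nh \<sigma> unfolding d_def by linarith
      have u: "0 \<le> ?u" using \<rho> h by simp
      have "integral {?u..?v} (\<lambda>_. ?c) \<le> integral {?u..?v} k"
        using u v Az_step[of i] h
        by (intro integral_le k_integrable_subinterval) (auto simp: divide_le_eq)
      moreover have "integral {?u..?v} (\<lambda>_. ?c) = norm (A (z (Suc i)) - A (z i))"
        using h unfolding uv by simp
      ultimately show ?thesis by simp
    qed
    have telescope: "norm (A (z i) - A (z 0)) \<le> integral {\<rho> + h..\<rho> + real (Suc i) * h} k"
      if "Suc i \<le> Suc N" for i
      using that
    proof (induction i)
      case 0
      then show ?case by simp
    next
      case (Suc i)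
      have "real (Suc (Suc i)) * h \<le> n * h"
        using Suc.prems h unfolding n_def by (intro mult_right_mono) auto
      then have v: "\<rho> + real (Suc (Suc i)) * h \<le> R" using nh \<sigma> unfolding d_def by linarith
      have "norm (A (z (Suc i)) - A (z 0))
          \<le> norm (A (z (Suc i)) - A (z i)) + norm (A (z i) - A (z 0))"
        using norm_triangle_ineq[of "A (z (Suc i)) - A (z i)" "A (z i) - A (z 0)"] by simp
      also have "\<dots> \<le> integral {\<rho> + real (Suc i) * h..\<rho> + real (Suc (Suc i)) * h} k
          + integral {\<rho> + h..\<rho> + real (Suc i) * h} k"
        using cell[of i] Suc by (intro add_mono) auto
      also have "\<dots> = integral {\<rho> + h..\<rho> + real (Suc (Suc i)) * h} k"
        using Henstock_Kurzweil_Integration.integral_combine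
          [of "\<rho> + h" "\<rho> + real (Suc i) * h" "\<rho> + real (Suc (Suc i)) * h" k]
          k_integrable_subinterval[OF _ v, of "\<rho> + h"] \<rho> h
        by (simp add: algebra_simps)
      finally show ?case .
    qed
    have end_point: "\<rho> + real (Suc N) * h = \<sigma>" using nh unfolding n_def d_def by linarith
    have h_le: "\<rho> + h \<le> \<sigma>" using end_point h mult_right_mono[of 1 "real (Suc N)" h] by linarith
    have z0: "z 0 = x" and zn: "z (Suc N) = y" using n by (auto simp: z_def n_def)
    have "norm (A y - A x) \<le> norm (A y - A (z N)) + norm (A (z N) - A x)"
      using norm_triangle_ineq[of "A y - A (z N)" "A (z N) - A x"] by simp
    also have "\<dots> \<le> k \<sigma> * h + integral {\<rho> + h..\<sigma>} k"
      using Az_step[of N \<sigma>] telescope[of N] \<sigma> unfolding end_point z0 zn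
      by (intro add_mono) auto
    also have "integral {\<rho> + h..\<sigma>} k \<le> integral {\<rho>..\<sigma>} k"
      using integral_split[of "\<rho> + h" \<sigma>] integral_split[of \<rho> "\<rho> + h"] integral_split[of \<rho> \<sigma>]
        integral_k_nonneg[of \<rho> "\<rho> + h"] \<rho> h h_le \<sigma> by simp
    finally show ?thesis by (simp add: h_def n_def algebra_simps)
  qed
  have "(\<lambda>N. integral {\<rho>..\<sigma>} k + k \<sigma> * d / real (Suc N)) \<longlonglongrightarrow> integral {\<rho>..\<sigma>} k + 0"
    by (intro tendsto_intros LIMSEQ_Suc lim_const_over_n)
  then show ?thesis
    using approx by (intro LIMSEQ_le_const) auto
qed

section \<open>A priori bounds for fixed points\<close>

lemma fixed_point_majorant_bounds:
  assumes "norm (y - x0) \<le> R" "A y = y"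
  shows "norm (y - x0) \<le> ap (norm (y - x0))" "am (norm (y - x0)) \<le> norm (y - x0)"
proof -
  have "norm (A y - A x0) \<le> integral {0..norm (y - x0)} k"
    using assms(1) by (intro norm_diff_le_integral) auto
  moreover have "norm (y - x0) \<le> norm (A y - A x0) + norm (A x0 - x0)"
    using norm_triangle_ineq[of "A y - A x0" "A x0 - x0"] assms(2) by simp
  moreover have "norm (A x0 - x0) \<le> norm (A y - A x0) + norm (y - x0)"
    using norm_triangle_ineq4[of "A x0 - A y" "x0 - y"] assms(2)
    by (simp add: norm_minus_commute)
  ultimately show "norm (y - x0) \<le> ap (norm (y - x0))" "am (norm (y - x0)) \<le> norm (y - x0)"
    unfolding majorant_plus_def majorant_minus_def by linarith+
qed

text \<open>
  Since \<open>am 0 \<ge> 0\<close> while \<open>am\<close> is below the diagonal at the distance of the fixed point, the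
  graph of \<open>am\<close> crosses the diagonal no later than there.
\<close>
lemma radius_lower_le_fixed_point:
  assumes "norm (y - x0) \<le> R" "A y = y"
  shows "radius_lower x0 R k A \<le> norm (y - x0)"
proof -
  have cont: "continuous_on {0..norm (y - x0)} (\<lambda>r. r - am r)"
    using assms(1)
    by (intro continuous_intros continuous_on_subset[OF continuous_majorants(2)]) auto
  have "\<exists>r\<ge>0. r \<le> norm (y - x0) \<and> r - am r = 0"
    using fixed_point_majorant_bounds(2)[OF assms] cont
    by (intro IVT') (auto simp: majorant_minus_def)
  then obtain r where r: "0 \<le> r" "r \<le> norm (y - x0)" "am r = r" by auto
  then have "r \<in> {0..R}" using assms(1) by simp
  then have "radius_lower x0 R k A \<le> r"
    unfolding radius_lower_def
    using Least_fixed_point_interval(3)[OF continuous_majorants(2)] r(3) by blast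
  then show ?thesis using r(2) by linarith
qed

text \<open>
  Some point of \<open>[\<parallel>y - x0\<parallel>, r]\<close> is a radius whose ball \<open>A\<close> contracts, because \<open>ap\<close> passes from
  on or above the diagonal to strictly below it.
\<close>
lemma fixed_points_eq_if_majorant_below_diagonal:
  assumes "r \<le> R" "ap r < r"
    and y: "norm (y - x0) \<le> r" "A y = y"
    and x: "norm (x - x0) \<le> norm (y - x0)" "A x = x"
  shows "x = y"
proof (rule ccontr)
  assume "x \<noteq> y"
  let ?\<rho> = "norm (y - x0)"
  have "?\<rho> \<le> ap ?\<rho>" using fixed_point_majorant_bounds(1) y assms(1) by simp
  then have "integral {?\<rho>..r} k < r - ?\<rho>"
    using majorant_plus_diff[of ?\<rho> r] assms(1,2) y(1) by simp
  then have "\<exists>\<tau>\<in>{?\<rho>..r}. k \<tau> < 1"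
    using assms(1) y(1) by (intro exists_less_of_integral_less k_integrable_subinterval) auto
  then obtain \<tau> where \<tau>: "?\<rho> \<le> \<tau>" "\<tau> \<le> r" "k \<tau> < 1" by auto
  have "?\<rho> \<noteq> 0" using \<open>x \<noteq> y\<close> x(1) by auto
  then have "0 < \<tau>" using \<tau>(1) norm_ge_zero[of "y - x0"] by linarith
  then have "norm (A x - A y) \<le> k \<tau> * norm (x - y)"
    using \<tau> assms(1) x(1) by (intro lipschitz) auto
  also have "\<dots> < norm (x - y)" using \<tau>(3) \<open>x \<noteq> y\<close> by simp
  finally show False using x(2) y(2) by simp
qed

end

section \<open>Picard iteration below the smallest fixed point of the majorant\<close>

locale majorized_operator = variable_lipschitz_operator x0 R k A
  for x0 :: "'a::banach" and R k A +
  assumes majorant_plus_fixed: "\<exists>r\<in>{0..R}. majorant_plus x0 k A r = r"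
begin

abbreviation "ru \<equiv> radius_upper x0 R k A"

lemma radius_upper:
  shows "0 \<le> ru" "ru \<le> R" "ap ru = ru" "\<And>r. 0 \<le> r \<Longrightarrow> r \<le> R \<Longrightarrow> ap r = r \<Longrightarrow> ru \<le> r"
proof -
  note least = Least_fixed_point_interval[OF continuous_majorants(1) majorant_plus_fixed,
      folded radius_upper_def]
  show "0 \<le> ru" "ru \<le> R" using least(1) by simp_all
  show "ap ru = ru" by (rule least(2))
  show "ru \<le> r" if "0 \<le> r" "r \<le> R" "ap r = r" for r
    using least(3)[of r] that by simp
qed

definition \<rho> :: "nat \<Rightarrow> real" where "\<rho> n = (ap ^^ n) 0"
definition X :: "nat \<Rightarrow> 'a" where "X n = (A ^^ n) x0"

lemma \<rho>_0: "\<rho> 0 = 0" and \<rho>_Suc: "\<rho> (Suc n) = ap (\<rho> n)"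
  and X_0: "X 0 = x0" and X_Suc: "X (Suc n) = A (X n)"
  by (simp_all add: \<rho>_def X_def)

lemma \<rho>_bounds: "0 \<le> \<rho> n \<and> \<rho> n \<le> \<rho> (Suc n) \<and> \<rho> (Suc n) \<le> ru"
proof (induction n)
  case 0
  have "0 \<le> ap 0" by (simp add: majorant_plus_def)
  then show ?case
    using majorant_plus_mono[of 0 ru] radius_upper by (simp add: \<rho>_0 \<rho>_Suc)
next
  case (Suc n)
  then show ?case
    using majorant_plus_mono[of "\<rho> n" "\<rho> (Suc n)"] majorant_plus_mono[of "\<rho> (Suc n)" ru]
      radius_upper by (simp add: \<rho>_Suc)
qed

lemma \<rho>_LIMSEQ: "\<rho> \<longlonglongrightarrow> ru"
proof -
  have "incseq \<rho>" using \<rho>_bounds by (intro incseq_SucI) auto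
  moreover have upper: "\<rho> n \<le> ru" for n using \<rho>_bounds[of n] by linarith
  ultimately obtain L where L: "\<rho> \<longlonglongrightarrow> L"
    using incseq_convergent[of \<rho> ru] by blast
  have "0 \<le> L" using L \<rho>_bounds by (intro LIMSEQ_le_const[OF L]) auto
  have "L \<le> ru" using upper by (intro LIMSEQ_le_const2[OF L]) auto
  have L_in: "L \<in> {0..R}" using \<open>0 \<le> L\<close> \<open>L \<le> ru\<close> radius_upper(2) by auto
  have "\<rho> n \<in> {0..R}" for n using \<rho>_bounds[of n] upper[of n] radius_upper(2) by auto
  then have "(\<lambda>n. ap (\<rho> n)) \<longlonglongrightarrow> ap L"
    by (intro continuous_on_tendsto_compose[OF continuous_majorants(1) L L_in]) auto
  moreover have "(\<lambda>n. ap (\<rho> n)) \<longlonglongrightarrow> L"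
    using LIMSEQ_Suc[OF L] by (simp add: \<rho>_Suc)
  ultimately have "ap L = L" by (rule LIMSEQ_unique)
  then have "ru \<le> L" using radius_upper(4) L_in by auto
  then show ?thesis using L \<open>L \<le> ru\<close> by simp
qed

text \<open>
  The radial interval over which \<open>norm_diff_le_integral\<close> is applied to consecutive iterates is
  exactly \<open>[\<rho> n, \<rho> (Suc n)]\<close>, over which \<open>k\<close> integrates to the next scalar increment.
\<close>
lemma X_bounds: "norm (X n - x0) \<le> \<rho> n \<and> norm (X (Suc n) - X n) \<le> \<rho> (Suc n) - \<rho> n"
proof (induction n)
  case 0
  show ?case by (simp add: X_0 X_Suc \<rho>_0 \<rho>_Suc majorant_plus_def)
next
  case (Suc n)
  have le_R: "\<rho> (Suc n) \<le> R" using \<rho>_bounds[of n] radius_upper(2) by linarith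
  have "norm (X (Suc n) - x0) \<le> norm (X (Suc n) - X n) + norm (X n - x0)"
    using norm_triangle_ineq[of "X (Suc n) - X n" "X n - x0"] by simp
  then have "norm (X (Suc n) - x0) \<le> \<rho> (Suc n)" using Suc by linarith
  moreover have "norm (A (X (Suc n)) - A (X n)) \<le> integral {\<rho> n..\<rho> (Suc n)} k"
    using Suc le_R by (intro norm_diff_le_integral) auto
  then have "norm (X (Suc (Suc n)) - X (Suc n)) \<le> \<rho> (Suc (Suc n)) - \<rho> (Suc n)"
    using majorant_plus_diff[of "\<rho> n" "\<rho> (Suc n)"] \<rho>_bounds[of n] le_R
    by (simp add: X_Suc \<rho>_Suc)
  ultimately show ?case ..
qed

text \<open>
  A fixed point plays the role of a later iterate: \<open>r\<^sup>*\<close> dominates it as \<open>\<rho> n\<close> dominates \<open>X n\<close>,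
  and both sides of the comparison are reproduced by one more application of \<open>A\<close> and \<open>ap\<close>.
\<close>
lemma fixed_point_dist_X:
  assumes "norm (y - x0) \<le> ru" "A y = y"
  shows "norm (y - X n) \<le> ru - \<rho> n"
proof (induction n)
  case 0
  then show ?case using assms by (simp add: X_0 \<rho>_0)
next
  case (Suc n)
  have "norm (A y - A (X n)) \<le> integral {\<rho> n..ru} k"
    using Suc X_bounds[of n] radius_upper(2) by (intro norm_diff_le_integral) auto
  moreover have "\<rho> n \<le> ru" using \<rho>_bounds[of n] by linarith
  ultimately show ?case
    using majorant_plus_diff[of "\<rho> n" ru] \<rho>_bounds[of n] radius_upper assms(2)
    by (simp add: X_Suc \<rho>_Suc)
qed

lemma X_LIMSEQ_fixed_point:
  assumes "norm (y - x0) \<le> ru" "A y = y"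
  shows "X \<longlonglongrightarrow> y"
proof -
  have "(\<lambda>n. ru - \<rho> n) \<longlonglongrightarrow> ru - ru" by (intro tendsto_intros \<rho>_LIMSEQ)
  then have lim: "(\<lambda>n. ru - \<rho> n) \<longlonglongrightarrow> 0" by simp
  have "\<forall>\<^sub>F n in sequentially. norm (X n - y) \<le> ru - \<rho> n"
    using fixed_point_dist_X[OF assms] by (simp add: norm_minus_commute)
  then have "(\<lambda>n. X n - y) \<longlonglongrightarrow> 0"
    by (rule Lim_null_comparison) (rule lim)
  then show ?thesis by (simp add: LIM_zero_iff)
qed

lemma fixed_point_unique_upper:
  assumes "norm (x - x0) \<le> ru" "A x = x" "norm (y - x0) \<le> ru" "A y = y"
  shows "x = y"
  using X_LIMSEQ_fixed_point assms LIMSEQ_unique by blast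

text \<open>The increments of \<open>X\<close> are dominated by those of the convergent monotone sequence \<open>\<rho>\<close>.\<close>
lemma fixed_point_exists: "\<exists>x. norm (x - x0) \<le> ru \<and> A x = x"
proof -
  have "summable (\<lambda>n. \<rho> (Suc n) - \<rho> n)"
    using telescope_summable[OF \<rho>_LIMSEQ] .
  then have "summable (\<lambda>n. X (Suc n) - X n)"
    by (rule summable_comparison_test[rotated]) (use X_bounds in auto)
  then have "convergent (\<lambda>n. \<Sum>i<n. X (Suc i) - X i)"
    by (simp add: summable_iff_convergent)
  then have "convergent (\<lambda>n. X n - X 0)"
    by (simp add: sum_lessThan_telescope)
  then have "convergent X"
    using convergent_add_const_right_iff[of X "- X 0"] by simp
  then obtain x where x: "X \<longlonglongrightarrow> x" by (auto simp: convergent_def)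
  have X_in: "norm (X n - x0) \<le> ru" for n
    using X_bounds[of n] \<rho>_bounds[of n] by linarith
  have "(\<lambda>n. norm (X n - x0)) \<longlonglongrightarrow> norm (x - x0)" by (intro tendsto_intros x)
  then have x_in: "norm (x - x0) \<le> ru" using X_in by (intro LIMSEQ_le_const2) auto
  have "norm (A (X n) - A x) \<le> k R * norm (X n - x)" for n
    using X_in[of n] x_in radius_upper(2) R_pos by (intro lipschitz) auto
  then have "\<forall>\<^sub>F n in sequentially. norm (A (X n) - A x) \<le> k R * norm (X n - x)" by simp
  moreover have "(\<lambda>n. X n - x) \<longlonglongrightarrow> 0" using x by (simp add: LIM_zero_iff)
  then have "(\<lambda>n. k R * norm (X n - x)) \<longlonglongrightarrow> 0"
    by (intro tendsto_mult_right_zero tendsto_norm_zero)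
  ultimately have "(\<lambda>n. A (X n) - A x) \<longlonglongrightarrow> 0" by (rule Lim_null_comparison)
  then have "(\<lambda>n. X (Suc n)) \<longlonglongrightarrow> A x" by (simp add: LIM_zero_iff X_Suc)
  then have "A x = x" using LIMSEQ_Suc[OF x] LIMSEQ_unique by blast
  with x_in show ?thesis by blast
qed

lemma fixed_point_unique_below_diagonal:
  assumes "r \<le> R" "ap r < r"
    and y: "norm (y - x0) \<le> r" "A y = y"
    and x: "norm (x - x0) \<le> ru" "A x = x"
  shows "x = y"
proof (cases "norm (y - x0) \<le> ru")
  case True
  then show ?thesis using fixed_point_unique_upper x y by blast
next
  case False
  then show ?thesis
    using fixed_points_eq_if_majorant_below_diagonal[OF assms(1,2) y] x by simp
qed

lemma below_diagonal_beyond: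
  assumes "ru \<le> r" "r < radius_unique x0 R k A"
  obtains r' where "r < r'" "r' \<le> R" "ap r' < r'"
proof -
  let ?S = "{r. ru < r \<and> r \<le> R \<and> ap r < r}"
  have "?S \<noteq> {}" and "radius_unique x0 R k A = Sup ?S"
    using assms by (auto simp: radius_unique_def Let_def split: if_splits)
  then obtain r' where "r' \<in> ?S" "r < r'"
    using assms(2) less_cSupE[of r ?S] by auto
  then show thesis using that by blast
qed

text \<open>
  When \<open>ap R < R\<close> the outer boundary of the layer is included: then \<open>R\<close> itself is a radius
  below the diagonal, so it serves for every fixed point at once.
\<close>
lemma fixed_point_notin_nonexistence_layer:
  assumes "norm (y - x0) \<le> R" "A y = y"
  shows "y \<notin> nonexistence_layer x0 R k A"
proof
  assume "y \<in> nonexistence_layer x0 R k A"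
  then have outside: "ru < norm (y - x0)"
    and "ap R < R \<or> norm (y - x0) < radius_unique x0 R k A"
    by (auto simp: nonexistence_layer_def split: if_splits)
  then consider "ap R < R" | "norm (y - x0) < radius_unique x0 R k A" by blast
  then obtain r where r: "norm (y - x0) \<le> r" "r \<le> R" "ap r < r"
  proof cases
    case 1
    then show thesis using that assms(1) by blast
  next
    case 2
    then obtain r where "norm (y - x0) < r" "r \<le> R" "ap r < r"
      using below_diagonal_beyond[of "norm (y - x0)"] outside by auto
    then show thesis using that[of r] by simp
  qed
  obtain x where "norm (x - x0) \<le> ru" "A x = x" using fixed_point_exists by blast
  then show False
    using fixed_point_unique_below_diagonal[OF r(2,3,1) assms(2)] outside by auto
qed

end

theorem theorem1:
  fixes x0 :: "'a::banach" and R :: real and A :: "'a \<Rightarrow> 'a" and k :: "real \<Rightarrow> real"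
  assumes "R > 0"
    and "\<forall>t\<in>{0..R}. 0 \<le> k t"
    and "k integrable_on {0..R}"
    and "variable_lipschitz x0 R k A"
    and "\<exists>r\<in>{0..R}. majorant_plus x0 k A r = r"
    and "\<exists>r\<in>{0..R}. majorant_minus x0 k A r = r"
  shows "\<exists>xs. fixed_points x0 R A \<inter> existence_layer x0 R k A = {xs}
    \<and> (\<forall>r. radius_upper x0 R k A \<le> r \<and> r < radius_unique x0 R k A \<longrightarrow>
           fixed_points x0 R A \<inter> cball x0 r = {xs})
    \<and> fixed_points x0 R A \<inter>
        ((cball x0 (radius_lower x0 R k A) - {xs}) \<union> nonexistence_layer x0 R k A) = {}"
proof -
  interpret majorized_operator x0 R k A
    by unfold_locales (use assms in auto)
  let ?rl = "radius_lower x0 R k A"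
  have fp: "x \<in> fixed_points x0 R A \<longleftrightarrow> norm (x - x0) \<le> R \<and> A x = x" for x
    by (simp add: fixed_points_def dist_norm norm_minus_commute)
  have ball: "cball x0 r = {x. norm (x - x0) \<le> r}" for r
    by (auto simp: dist_norm norm_minus_commute)
  obtain xs where xs: "norm (xs - x0) \<le> ru" "A xs = xs" using fixed_point_exists by blast
  have xs_fp: "xs \<in> fixed_points x0 R A" using xs radius_upper(2) by (simp add: fp)
  have lower: "?rl \<le> norm (y - x0)" if "y \<in> fixed_points x0 R A" for y
    using radius_lower_le_fixed_point that by (simp add: fp)
  have unique: "y = xs" if "y \<in> fixed_points x0 R A" "norm (y - x0) \<le> ru" for y
    using fixed_point_unique_upper that xs by (simp add: fp)
  have "?rl \<le> ru" using lower[OF xs_fp] xs(1) by linarith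
  have "fixed_points x0 R A \<inter> existence_layer x0 R k A = {xs}"
    using xs_fp lower[OF xs_fp] xs(1) unique unfolding existence_layer_def by blast
  moreover have "fixed_points x0 R A \<inter> cball x0 r = {xs}"
    if r: "ru \<le> r" "r < radius_unique x0 R k A" for r
  proof -
    obtain r' where r': "r < r'" "r' \<le> R" "ap r' < r'" using below_diagonal_beyond[OF r] .
    have "y = xs" if "y \<in> fixed_points x0 R A" "norm (y - x0) \<le> r" for y
      using fixed_point_unique_below_diagonal[OF r'(2,3) _ _ xs, of y] that r'(1)
      by (auto simp: fp)
    moreover have "norm (xs - x0) \<le> r" using xs(1) r(1) by linarith
    ultimately show ?thesis using xs_fp unfolding ball by blast
  qed
  moreover have "fixed_points x0 R A \<inter> (cball x0 ?rl - {xs}) = {}"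
    using unique order_trans[OF _ \<open>?rl \<le> ru\<close>] unfolding ball by blast
  moreover have "fixed_points x0 R A \<inter> nonexistence_layer x0 R k A = {}"
    using fixed_point_notin_nonexistence_layer by (auto simp: fp)
  ultimately show ?thesis by blast
qed

end
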